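(* Let $\lambda>-1$ and $t>0$, and let $\alpha_n=\alpha_n(t)$, $\beta_n=\beta_n(t)$ be the recurrence coefficients of the monic orthogonal polynomials with respect to the weight $w(x;t)=x^{\lambda}e^{-x^3-t/x}$ on $(0,\infty)$. Put $$R_n:=3\left(\alpha_n^2+\beta_n+\beta_{n+1}\right),\qquad r_n:=3(\alpha_n+\alpha_{n-1})\beta_n-n .$$ Then, for every $n\ge 1$, $\alpha_n$ and $\beta_n$ satisfy the following system of nonlinear third-order difference equations: $$\begin{aligned} &\left[\left(r_n+r_{n+1}+\alpha_nR_n-\lambda\right)\beta_nR_{n-1}+\left(r_{n-1}+r_{n}+\alpha_{n-1}R_{n-1}-\lambda\right)\beta_nR_{n}+tr_n\right]\\ &\times\left[\left(r_n+r_{n+1}+\alpha_nR_n-\lambda\right)\beta_nR_{n-1}+\left(r_{n-1}+r_{n}+\alpha_{n-1}R_{n-1}-\lambda\right)\beta_nR_{n}-tr_n+\lambda t\right]\\ &=\beta_n(2r_n-\lambda)^2\left(r_n+r_{n+1}+\alpha_nR_n-\lambda\right)\left(r_{n-1}+r_{n}+\alpha_{n-1}R_{n-1}-\lambda\right) \end{aligned}$$ and $$\begin{aligned} &2\left(r_n+r_{n+1}+\alpha_nR_n-\lambda\right)\beta_nR_{n-1}+2\left(r_{n-1}+r_{n}+\alpha_{n-1}R_{n-1}-\lambda\right)\beta_nR_{n}+2tr_n\\ &+(2r_n-\lambda)\left[\alpha_n\left(r_n+r_{n+1}+\alpha_nR_n-\lambda-1\right)+3\beta_n^2-3\beta_{n+1}^2-t\right]\\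 &=(2r_n-\lambda)\left[\beta_n\left(3\alpha_n\alpha_{n-1}+R_{n}+R_{n-1}\right)-\beta_{n+1}\left(3\alpha_{n+1}\alpha_{n}+R_{n+1}+R_{n}\right)\right]. \end{aligned}$$
   Context: For $\lambda>-1$, $t>0$ let $w(x;t)=x^{\lambda}e^{-x^3-t/x}$, $x\in(0,\infty)$. Let $P_n(x)=P_n(x;t)$, $n=0,1,2,\dots$, be the monic polynomials of degree $n$ with $\int_0^\infty P_m(x;t)P_n(x;t)w(x;t)\,dx=h_n(t)\delta_{mn}$, $h_n(t)>0$. The recurrence coefficients $\alpha_n$ ($n\ge0$) and $\beta_n$ ($n\ge 1$) are defined by the three-term recurrence relation $xP_n(x;t)=P_{n+1}(x;t)+\alpha_n(t)P_n(x;t)+\beta_n(t)P_{n-1}(x;t)$, with $P_0=1$ and $\beta_0P_{-1}=0$; equivalently $\alpha_n=\frac1{h_n}\int_0^\infty xP_n^2w\,dx$ and $\beta_n=h_n/h_{n-1}$. Convention: $\beta_0=0$, and any term containing the factor $\beta_0$ is $0$ (so $r_0=0$). *)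

theory Defs
  imports "HOL-Analysis.Analysis" "HOL-Computational_Algebra.Polynomial"
begin

text \<open>Only the values on \<open>(0,\<infinity>)\<close> matter.\<close>

definition weight :: "real \<Rightarrow> real \<Rightarrow> real \<Rightarrow> real" where
  "weight lam t x = x powr lam * exp (- (x ^ 3) - t / x)"

text \<open>No separate integrability condition: for \<^const>\<open>weight\<close> with \<open>lam > -1\<close> and \<open>t > 0\<close> all
  the integrals converge absolutely.\<close>

definition monic_orthogonal_polys ::
    "(real \<Rightarrow> real) \<Rightarrow> (nat \<Rightarrow> real poly) \<Rightarrow> (nat \<Rightarrow> real) \<Rightarrow> bool" where
  "monic_orthogonal_polys w P h \<longleftrightarrow>
     (\<forall>n. degree (P n) = n \<and> lead_coeff (P n) = 1) \<and>
     (\<forall>m n. (LBINT x:{0<..}. poly (P m) x * poly (P n) x * w x) = (if m = n then h n else 0)) \<and>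
     (\<forall>n. h n > 0)"

text \<open>The conventions \<open>\<beta>\<^sub>0 = 0\<close> and \<open>\<beta>\<^sub>0 P\<^sub>-\<^sub>1 = 0\<close> are built in.\<close>

definition recurrence_coeffs ::
    "(nat \<Rightarrow> real poly) \<Rightarrow> (nat \<Rightarrow> real) \<Rightarrow> (nat \<Rightarrow> real) \<Rightarrow> bool" where
  "recurrence_coeffs P \<alpha> \<beta> \<longleftrightarrow>
     \<beta> 0 = 0 \<and>
     (\<forall>n x. x * poly (P n) x =
        poly (P (n + 1)) x + \<alpha> n * poly (P n) x
          + (if n = 0 then 0 else \<beta> n * poly (P (n - 1)) x))"

definition R_coeff :: "(nat \<Rightarrow> real) \<Rightarrow> (nat \<Rightarrow> real) \<Rightarrow> nat \<Rightarrow> real" where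
  "R_coeff \<alpha> \<beta> n = 3 * ((\<alpha> n)\<^sup>2 + \<beta> n + \<beta> (n + 1))"

text \<open>For \<open>n = 0\<close> the truncated index \<open>n - 1\<close> is harmless: the factor \<open>\<beta> 0 = 0\<close> makes the
  value \<open>0\<close>.\<close>

definition r_coeff :: "(nat \<Rightarrow> real) \<Rightarrow> (nat \<Rightarrow> real) \<Rightarrow> nat \<Rightarrow> real" where
  "r_coeff \<alpha> \<beta> n = 3 * (\<alpha> n + \<alpha> (n - 1)) * \<beta> n - real n"

end

theory Submission
  imports Defs
begin

text \<open>Write \<open>w\<close> for the weight, \<open>v = x^3 + t/x - \<lambda> ln x\<close> for its potential, so that
  \<open>w' = - v' w\<close> with \<open>v' = 3 x^2 - \<lambda>/x - t/x^2\<close>. As \<open>w\<close> decays faster than any power both at \<open>0\<close> and at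
  \<open>\<infinity>\<close>, the integral of \<open>(p w)'\<close> over the half-line vanishes for every polynomial \<open>p\<close>:
  \<open>\<integral> p' w = \<integral> v' p w\<close>.
  This is the only analytic input (\<open>mom_pderiv\<close>). Everything else is algebra with the three
  functionals \<open>p \<mapsto> \<integral> p w\<close>, \<open>p \<mapsto> \<integral> p w / x\<close> and \<open>p \<mapsto> \<integral> p w / x^2\<close>.

  Integrating \<open>(P\<^sub>n\<^sup>2 w)'\<close>, \<open>(x P\<^sub>n\<^sup>2 w)'\<close> and \<open>(P\<^sub>n\<^sub>+\<^sub>1 P\<^sub>n w)'\<close> identifies \<open>R\<^sub>n\<close>,
  \<open>X\<^sub>n = r\<^sub>n + r\<^sub>n\<^sub>+\<^sub>1 + \<alpha>\<^sub>n R\<^sub>n - \<lambda>\<close> and \<open>r\<^sub>n\<^sub>+\<^sub>1\<close> as moments of \<open>P\<^sub>n\<^sup>2\<close> or \<open>P\<^sub>n\<^sub>+\<^sub>1 P\<^sub>n\<close> against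
  \<open>w/x\<close> and \<open>w/x^2\<close> (\<open>R_moments\<close>, \<open>X_moments\<close>, \<open>r_moments\<close>). One further moment is needed,
  \<open>Y\<^sub>n = (t/h\<^sub>n) \<integral> P\<^sub>n\<^sub>+\<^sub>1 P\<^sub>n w/x\<close>. Together with
  polynomial parts in \<open>z\<close> these sequences make up the coefficients of the ladder operators of the polynomials, and the theorem is what the compatibility of the ladder operators says about them:
  \<^item> \<open>Y\<^sub>n (Y\<^sub>n - t) = \<beta>\<^sub>n\<^sub>+\<^sub>1 X\<^sub>n\<^sub>+\<^sub>1 X\<^sub>n\<close> (\<open>Y_quadratic\<close>);
  \<^item> \<open>(2 r\<^sub>n\<^sub>+\<^sub>1 - \<lambda>) Y\<^sub>n = t r\<^sub>n\<^sub>+\<^sub>1 + \<beta>\<^sub>n\<^sub>+\<^sub>1 (X\<^sub>n\<^sub>+\<^sub>1 R\<^sub>n + X\<^sub>n R\<^sub>n\<^sub>+\<^sub>1)\<close> (\<open>Y_linear\<close>);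
  \<^item> \<open>Y\<^sub>n\<^sub>+\<^sub>1 + Y\<^sub>n = t - \<alpha>\<^sub>n\<^sub>+\<^sub>1 X\<^sub>n\<^sub>+\<^sub>1\<close> (\<open>Y_sum\<close>);
  \<^item> \<open>Y\<^sub>n - Y\<^sub>n\<^sub>+\<^sub>1\<close> is an explicit polynomial in the \<open>\<alpha>\<close> and \<open>\<beta>\<close> (\<open>Y_diff\<close>).

  Eliminating \<open>Y\<^sub>n\<close> from the first two gives the first difference equation. Adding the last two gives
  \<open>2 Y\<^sub>n\<close>, and comparison with the second gives the second difference equation.

  The first three relations come from orthogonality:
  \<open>\<integral> P\<^sub>m P\<^sub>n w/x\<close> depends on \<open>P\<^sub>m\<close> only through \<open>P\<^sub>m(0)\<close> when \<open>m \<le> n\<close>, and similarly \<open>\<integral> P\<^sub>m P\<^sub>n w/x^2\<close> only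
  through \<open>P\<^sub>m(0)\<close> and \<open>P\<^sub>m'(0)\<close>. So all these moments are bilinear in \<open>P\<^sub>n(0)\<close>, \<open>P\<^sub>n'(0)\<close>, \<open>\<integral> P\<^sub>n w/x\<close> and
  \<open>\<integral> P\<^sub>n w/x^2\<close>, and the relations reduce to the Casorati identity \<open>casorati\<close> and the recurrence at \<open>x = 0\<close>.\<close>

section \<open>The weight and its moments\<close>

text \<open>The factor \<open>exp (- t / x)\<close> beats every power of \<open>x\<close> at \<open>0\<close>, so the exponent \<open>\<mu>\<close> can be raised to a
  positive one at the cost of a constant; this dominates the weight by a Gamma integrand for every real \<open>\<mu>\<close>.\<close>

lemma weight_bound:
  assumes t: "t > 0"
  obtains C a where "a > 0" "\<And>x. x > 0 \<Longrightarrow> weight \<mu> t x \<le> C * (x powr a / exp x)"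
proof -
  define N :: nat where "N = Suc (nat \<lceil>- \<mu>\<rceil>)"
  \<comment> \<open>\<open>exp y \<ge> (y / N)^N\<close> at \<open>y = t / x\<close> raises the exponent by \<open>N\<close>; the factor \<open>exp 1\<close> comes
    from \<open>x^3 \<ge> x - 1\<close>.\<close>
  define C where "C = exp 1 * (real N / t) ^ N"
  have N: "N > 0" "\<mu> + N > 0" by (auto simp: N_def) linarith
  have "weight \<mu> t x \<le> C * (x powr (\<mu> + N) / exp x)" if x: "x > 0" for x
  proof -
    have "(t / (x * N)) ^ N \<le> (1 + (t / x) / N) ^ N"
      using x N t by (intro power_mono) (auto simp: field_simps)
    also have "\<dots> \<le> exp (t / x)"
      using exp_ge_one_plus_x_over_n_power_n[of N "t/x"] x N t
      by (smt (verit) divide_pos_pos of_nat_0_le_iff)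
    finally have "inverse (exp (t / x)) \<le> inverse ((t / (x * N)) ^ N)"
      using x N t by (intro le_imp_inverse_le) auto
    then have 1: "exp (- (t / x)) \<le> (N / t) ^ N * x ^ N"
      by (simp add: exp_minus power_mult_distrib power_divide field_simps)
    have "x - 1 \<le> x ^ 3"
    proof (cases "x \<le> 1")
      case False
      then have "x ^ 1 \<le> x ^ 3" by (intro power_increasing) auto
      then show ?thesis by simp
    qed (use x in \<open>smt (verit) zero_le_power\<close>)
    then have 2: "exp (- (x ^ 3)) \<le> exp (1 - x)" by simp
    have "weight \<mu> t x = x powr \<mu> * (exp (- (x ^ 3)) * exp (- (t / x)))"
      by (simp add: weight_def flip: exp_add)
    also have "\<dots> \<le> x powr \<mu> * (exp (1 - x) * ((N / t) ^ N * x ^ N))"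
      using 1 2 by (intro mult_left_mono mult_mono) auto
    also have "\<dots> = C * (x powr (\<mu> + N) / exp x)"
      using x by (simp add: C_def powr_add powr_realpow exp_diff)
    finally show ?thesis .
  qed
  with N(2) show thesis by (rule that)
qed

lemma weight_nonneg: "weight \<mu> t x \<ge> 0"
  by (simp add: weight_def)

lemma weight_integrable:
  assumes "t > 0"
  shows "set_integrable lborel {0<..} (weight \<mu> t)"
proof -
  obtain C a where a: "a > 0" and bd: "\<And>x. x > 0 \<Longrightarrow> weight \<mu> t x \<le> C * (x powr a / exp x)"
    using weight_bound[OF assms] by blast
  have "(\<lambda>x. x powr (a + 1 - 1) / exp x) absolutely_integrable_on {0..}"
    using Gamma_integral_real[of "a + 1"] a
    by (intro nonnegative_absolutely_integrable_1) (auto simp: has_integral_integrable_integral)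
  then have "(\<lambda>x. x powr a / exp x) absolutely_integrable_on {0..}" by simp
  then have "(\<lambda>x. x powr a / exp x) absolutely_integrable_on {0<..}"
    by (rule set_integrable_subset) auto
  then have "set_integrable lborel {0<..} (\<lambda>x. x powr a / exp x)"
    unfolding set_integrable_def by (subst (asm) integrable_completion) auto
  then have *: "set_integrable lborel {0<..} (\<lambda>x. C * (x powr a / exp x))"
    by (rule set_integrable_mult_right)
  show ?thesis
  proof (rule set_integrable_bound[OF *])
    show "set_borel_measurable lborel {0<..} (weight \<mu> t)"
      unfolding set_borel_measurable_def weight_def by measurable
    show "AE x in lborel. x \<in> {0<..} \<longrightarrow> norm (weight \<mu> t x) \<le> norm (C * (x powr a / exp x))"
      using bd weight_nonneg[of \<mu> t] by (intro AE_I2) (smt (verit) greaterThan_iff real_norm_def)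
  qed
qed

lemma weight_has_derivative:
  assumes "x > 0"
  shows "(weight \<mu> t has_real_derivative
     \<mu> * weight (\<mu> - 1) t x - 3 * weight (\<mu> + 2) t x + t * weight (\<mu> - 2) t x) (at x)"
proof -
  have [simp]: "x powr (\<mu> - 2) = x powr \<mu> / x\<^sup>2" "x powr (\<mu> + 2) = x powr \<mu> * x\<^sup>2" "x powr (\<mu> - 1) = x powr \<mu> / x"
    using assms by (simp_all add: powr_diff powr_add)
  show ?thesis
    unfolding weight_def[abs_def] using assms
    by (auto intro!: derivative_eq_intros simp: field_simps power2_eq_square power3_eq_cube)
qed

lemma weight_tendsto_0:
  assumes "t > 0"
  shows "(weight \<mu> t \<longlongrightarrow> 0) (at_right 0)" "(weight \<mu> t \<longlongrightarrow> 0) at_top"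
proof -
  obtain C a where a: "a > 0" and bd: "\<And>x. x > 0 \<Longrightarrow> weight \<mu> t x \<le> C * (x powr a / exp x)"
    using weight_bound[OF assms] by blast
  have "((\<lambda>x::real. x powr a) \<longlongrightarrow> 0 powr a) (at_right 0)"
    using a by (intro tendsto_powr' tendsto_intros)
      (auto intro: eventually_mono[OF eventually_at_right_less])
  then have "((\<lambda>x. C * (x powr a / exp x)) \<longlongrightarrow> C * (0 / exp 0)) (at_right 0)"
    using a by (intro tendsto_intros) auto
  then have lim: "((\<lambda>x. C * (x powr a / exp x)) \<longlongrightarrow> 0) (at_right 0)" by simp
  have "\<forall>\<^sub>F x in at_right 0. weight \<mu> t x \<le> C * (x powr a / exp x)"
    using eventually_at_right_less by (rule eventually_mono) (rule bd)
  then show "(weight \<mu> t \<longlongrightarrow> 0) (at_right 0)"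
    by (intro tendsto_sandwich[OF _ _ tendsto_const lim]) (auto simp: weight_nonneg)
  define k where "k = nat \<lceil>a\<rceil>"
  have "((\<lambda>x::real. \<bar>C\<bar> * (x ^ k / exp x)) \<longlongrightarrow> \<bar>C\<bar> * 0) at_top"
    by (intro tendsto_intros tendsto_power_div_exp_0)
  then have lim: "((\<lambda>x::real. \<bar>C\<bar> * (x ^ k / exp x)) \<longlongrightarrow> 0) at_top" by simp
  have bd': "weight \<mu> t x \<le> \<bar>C\<bar> * (x ^ k / exp x)" if "x \<ge> 1" for x
  proof -
    have "x powr a \<le> x powr k"
      using that unfolding k_def by (intro powr_mono) linarith+
    then have "x powr a \<le> x ^ k" using that by (simp add: powr_realpow)
    then have "\<bar>C\<bar> * (x powr a / exp x) \<le> \<bar>C\<bar> * (x ^ k / exp x)"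
      by (intro mult_left_mono divide_right_mono) auto
    moreover have "C * (x powr a / exp x) \<le> \<bar>C\<bar> * (x powr a / exp x)"
      by (intro mult_right_mono) auto
    ultimately show ?thesis using bd[of x] that by linarith
  qed
  have "\<forall>\<^sub>F x in at_top. weight \<mu> t x \<le> \<bar>C\<bar> * (x ^ k / exp x)"
    using eventually_ge_at_top[of 1] by (rule eventually_mono) (rule bd')
  then show "(weight \<mu> t \<longlongrightarrow> 0) at_top"
    by (intro tendsto_sandwich[OF _ _ tendsto_const lim]) (auto simp: weight_nonneg)
qed

lemma mult_weight: "x > 0 \<Longrightarrow> x * weight \<mu> t x = weight (\<mu> + 1) t x"
  by (simp add: weight_def powr_add)

text \<open>The integrated form of \<open>weight_has_derivative\<close>: both boundary values of the weight vanish. Having it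
  for all real exponents makes the passage from monomials to polynomials a plain induction.\<close>

lemma weight_moment_recurrence:
  assumes t: "t > 0"
  shows "\<mu> * (LBINT x:{0<..}. weight (\<mu> - 1) t x) - 3 * (LBINT x:{0<..}. weight (\<mu> + 2) t x)
     + t * (LBINT x:{0<..}. weight (\<mu> - 2) t x) = 0"
proof -
  let ?f = "\<lambda>x. \<mu> * weight (\<mu> - 1) t x - 3 * weight (\<mu> + 2) t x + t * weight (\<mu> - 2) t x"
  note int = weight_integrable[OF t]
  have I: "set_integrable lborel {0<..} ?f"
    by (intro set_integral_add set_integral_diff set_integrable_mult_right int)
  have "(LBINT x=0..\<infinity>. ?f x) = 0 - 0"
  proof (rule interval_integral_FTC_integrable[where F="weight \<mu> t"])
    show "(weight \<mu> t has_vector_derivative ?f x) (at x)" if "0 < ereal x" for x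
      using weight_has_derivative[of x \<mu> t] that by (simp add: has_real_derivative_iff_has_vector_derivative)
    show "isCont ?f x" if "0 < ereal x" for x
      using that unfolding weight_def by (auto intro!: continuous_intros)
    show "((weight \<mu> t \<circ> real_of_ereal) \<longlongrightarrow> 0) (at_right 0)"
      using weight_tendsto_0(1)[OF t] by (simp add: zero_ereal_def ereal_tendsto_simps)
    show "((weight \<mu> t \<circ> real_of_ereal) \<longlongrightarrow> 0) (at_left \<infinity>)"
      using weight_tendsto_0(2)[OF t] by (simp add: ereal_tendsto_simps)
  qed (use I in \<open>auto simp: zero_ereal_def\<close>)
  then have "(LBINT x:{0<..}. ?f x) = 0"
    by (simp add: interval_lebesgue_integral_0_infty)
  then show ?thesis
    using int by simp
qed

text \<open>Shifting the exponent \<open>\<mu>\<close> by an integer multiplies the integrand by a power of \<open>x\<close>, so the family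
  \<open>mom t \<mu>\<close> also covers the integrals of \<open>p w / x\<close> and \<open>p w / x^2\<close>.\<close>

definition mom :: "real \<Rightarrow> real \<Rightarrow> real poly \<Rightarrow> real" where
  "mom t \<mu> p = (LBINT x:{0<..}. poly p x * weight \<mu> t x)"

lemma poly_weight_integrable:
  assumes t: "t > 0"
  shows "set_integrable lborel {0<..} (\<lambda>x. poly p x * weight \<mu> t x)"
proof (induction p arbitrary: \<mu>)
  case 0
  then show ?case by (simp add: set_integrable_def)
next
  case (pCons a p)
  have "set_integrable lborel {0<..} (\<lambda>x. a * weight \<mu> t x + poly p x * weight (\<mu> + 1) t x)"
    by (intro set_integral_add set_integrable_mult_right weight_integrable t pCons.IH)
  moreover have "a * weight \<mu> t x + poly p x * weight (\<mu> + 1) t x = poly (pCons a p) x * weight \<mu> t x"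
    if "x > 0" for x
    using that by (simp flip: mult_weight) (simp add: algebra_simps)
  ultimately show ?case
    by (subst set_integrable_cong[OF refl, where f' = "\<lambda>x. a * weight \<mu> t x + poly p x * weight (\<mu> + 1) t x"]) auto
qed

context
  fixes t :: real
  assumes t: "t > 0"
begin

lemma mom_add: "mom t \<mu> (p + q) = mom t \<mu> p + mom t \<mu> q"
  by (simp add: mom_def distrib_right set_integral_add poly_weight_integrable[OF t])

lemma mom_diff: "mom t \<mu> (p - q) = mom t \<mu> p - mom t \<mu> q"
  by (simp add: mom_def left_diff_distrib set_integral_diff poly_weight_integrable[OF t])

lemma mom_smult: "mom t \<mu> (smult c p) = c * mom t \<mu> p"
  by (simp add: mom_def mult.assoc)

lemma mom_0: "mom t \<mu> 0 = 0"
  by (simp add: mom_def)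

lemma mom_pCons_0: "mom t \<mu> (pCons 0 p) = mom t (\<mu> + 1) p"
  unfolding mom_def by (rule set_lebesgue_integral_cong) (auto simp flip: mult_weight)

lemma mom_pCons: "mom t \<mu> (pCons a p) = a * mom t \<mu> 1 + mom t (\<mu> + 1) p"
proof -
  have "pCons a p = smult a 1 + pCons 0 p" by (simp add: one_pCons)
  then show ?thesis by (simp only: mom_add mom_smult mom_pCons_0)
qed

text \<open>Integration by parts against the weight, \<open>\<integral> p' w = \<integral> v' p w\<close>.\<close>

lemma mom_pderiv:
  "mom t \<mu> (pderiv p) = 3 * mom t (\<mu> + 2) p - \<mu> * mom t (\<mu> - 1) p - t * mom t (\<mu> - 2) p"
proof (induction p arbitrary: \<mu>)
  case 0
  then show ?case by (simp add: mom_0)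
next
  case (pCons a p)
  have "\<mu> * mom t (\<mu> - 1) 1 - 3 * mom t (\<mu> + 2) 1 + t * mom t (\<mu> - 2) 1 = 0"
    using weight_moment_recurrence[OF t, of \<mu>] by (simp add: mom_def)
  then have "a * (\<mu> * mom t (\<mu> - 1) 1 - 3 * mom t (\<mu> + 2) 1 + t * mom t (\<mu> - 2) 1) = 0"
    by simp
  then show ?case
    using pCons.IH[of "\<mu> + 1"]
    by (simp add: pderiv_pCons mom_pCons mom_pCons_0 mom_add algebra_simps)
qed

end

section \<open>Orthogonality and the recurrence\<close>

locale weight_orthogonal_polys =
  fixes lam t :: real and P :: "nat \<Rightarrow> real poly" and h \<alpha> \<beta> :: "nat \<Rightarrow> real"
  assumes t: "t > 0"
    and mop: "monic_orthogonal_polys (weight lam t) P h"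
    and rc: "recurrence_coeffs P \<alpha> \<beta>"
begin

lemmas mom_simps = mom_add[OF t] mom_diff[OF t] mom_smult[OF t] mom_0[OF t] mom_pCons_0[OF t]

lemma degree_P [simp]: "degree (P n) = n" and coeff_P_self [simp]: "coeff (P n) n = 1"
  and h_pos: "h n > 0"
  using mop by (auto simp: monic_orthogonal_polys_def) metis

lemma orth: "mom t lam (P m * P n) = (if m = n then h n else 0)"
  using mop by (simp add: monic_orthogonal_polys_def mom_def)

lemma beta_0: "\<beta> 0 = 0"
  using rc by (simp add: recurrence_coeffs_def)

text \<open>The term at index \<open>n - 1\<close> needs no case distinction: for \<open>n = 0\<close> its factor \<open>\<beta> 0\<close> is \<open>0\<close>.\<close>

lemma rec: "pCons 0 (P n) = P (Suc n) + smult (\<alpha> n) (P n) + smult (\<beta> n) (P (n - 1))"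
proof (rule poly_ext)
  show "poly (pCons 0 (P n)) x = poly (P (Suc n) + smult (\<alpha> n) (P n) + smult (\<beta> n) (P (n - 1))) x" for x
    using rc by (cases "n = 0") (auto simp: recurrence_coeffs_def)
qed

text \<open>Integrating against \<open>P\<^sub>n\<close> reads off the coefficient of \<open>x^n\<close>: subtracting the multiple of \<open>P\<^sub>k\<close>
  that cancels the coefficient of \<open>x^k\<close> lowers the degree. The hypothesis is on coefficients, not on the
  degree, so that the induction can start at the zero polynomial.\<close>

lemma mom_P_mult_coeff_zero:
  assumes "\<forall>i\<ge>k. coeff q i = 0" "k \<le> Suc n"
  shows "mom t lam (P n * q) = h n * coeff q n"
  using assms
proof (induction k arbitrary: q)
  case 0
  then have "q = 0" by (intro poly_eqI) auto
  then show ?case by (simp add: mom_simps)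
next
  case (Suc k)
  define q' where "q' = q - smult (coeff q k) (P k)"
  have q': "coeff q' i = 0" if "i \<ge> k" for i
  proof (cases "i = k")
    case False
    then show ?thesis using Suc.prems that by (simp add: q'_def coeff_eq_0)
  qed (simp add: q'_def)
  have "P n * q = smult (coeff q k) (P n * P k) + P n * q'"
    by (simp add: q'_def algebra_simps)
  then have "mom t lam (P n * q) = coeff q k * mom t lam (P n * P k) + mom t lam (P n * q')"
    by (simp only: mom_simps)
  also have "mom t lam (P n * q') = 0"
    using Suc.IH[of q'] Suc.prems q' by simp
  finally show ?case
    using Suc.prems by (auto simp: orth)
qed

lemma mom_P_mult:
  assumes "degree q \<le> n"
  shows "mom t lam (P n * q) = h n * coeff q n"
  using assms by (intro mom_P_mult_coeff_zero[of "Suc n"]) (auto simp: coeff_eq_0)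

text \<open>Up to sign, \<open>s n\<close> and \<open>u n\<close> are the value and the derivative at \<open>0\<close> of the function of the second
  kind that belongs to \<open>P n\<close>. Splitting off the lowest coefficients of \<open>q\<close> reduces every integral of
  \<open>P\<^sub>n q w / x\<close> or \<open>P\<^sub>n q w / x^2\<close> to them. The two lemmas admit a degree of \<open>q\<close> above \<open>n\<close>, so that an integral
  of \<open>P\<^sub>n P\<^sub>n\<^sub>+\<^sub>1\<close> can be evaluated by expanding either factor at \<open>0\<close>.\<close>

definition s where "s n = mom t (lam - 1) (P n)"
definition u where "u n = mom t (lam - 2) (P n)"

lemma mom_inv_P_mult:
  assumes "degree q \<le> Suc n"
  shows "mom t (lam - 1) (P n * q) = coeff q 0 * s n + h n * coeff q (Suc n)"
proof (cases q)
  case (pCons c p)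
  have "degree p \<le> n" using assms by (auto simp: pCons split: if_splits)
  then show ?thesis
    by (simp add: pCons mult_pCons_right mom_simps mom_P_mult s_def)
qed

lemma mom_inv2_P_mult:
  assumes "degree q \<le> Suc (Suc n)"
  shows "mom t (lam - 2) (P n * q) = coeff q 0 * u n + coeff q 1 * s n + h n * coeff q (Suc (Suc n))"
proof (cases q)
  case (pCons c p)
  have "degree p \<le> Suc n" using assms by (auto simp: pCons split: if_splits)
  moreover have "lam - 2 + 1 = lam - 1" by simp
  ultimately show ?thesis
    by (simp add: pCons mult_pCons_right mom_simps mom_inv_P_mult u_def)
qed

section \<open>Moments of products in terms of the recurrence coefficients\<close>

text \<open>The recurrence removes one power of \<open>x\<close> at a time, so a cubic moment of neighbouring polynomials
  involves only a few neighbouring recurrence coefficients.\<close>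

definition J where "J k m n = mom t (lam + real k) (P m * P n)"

lemma J_sym: "J k m n = J k n m"
  by (simp add: J_def mult.commute)

lemma J_0: "J 0 m n = (if m = n then h n else 0)"
  by (simp add: J_def orth)

lemma J_Suc: "J (Suc k) m n = J k (Suc m) n + \<alpha> m * J k m n + \<beta> m * J k (m - 1) n"
proof -
  have "J (Suc k) m n = mom t (lam + real k) (pCons 0 (P m) * P n)"
    by (simp add: J_def mom_simps add_ac)
  also have "\<dots> = mom t (lam + real k) (P (Suc m) * P n + smult (\<alpha> m) (P m * P n) + smult (\<beta> m) (P (m - 1) * P n))"
    by (simp only: rec distrib_right mult_smult_left)
  finally show ?thesis by (simp only: mom_simps J_def)
qed

text \<open>The integral of \<open>x P\<^sub>n P\<^sub>n\<^sub>+\<^sub>1 w\<close>, with the recurrence applied to either factor.\<close>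

lemma h_Suc: "h (Suc n) = \<beta> (Suc n) * h n"
  using J_Suc[of 0 n "Suc n"] J_Suc[of 0 "Suc n" n] J_sym[of 1 n "Suc n"]
  by (simp add: J_0 split: if_splits)

lemma J_1: "J (Suc 0) n n = \<alpha> n * h n" "J (Suc 0) (Suc n) n = h (Suc n)"
  "m > Suc n \<Longrightarrow> J (Suc 0) m n = 0"
proof -
  show "J (Suc 0) n n = \<alpha> n * h n"
    using J_Suc[of 0 n n] beta_0 by (cases n) (simp_all add: J_0)
  show "J (Suc 0) (Suc n) n = h (Suc n)"
    using J_Suc[of 0 "Suc n" n] by (simp add: J_0 h_Suc)
  show "J (Suc 0) m n = 0" if "m > Suc n"
    using J_Suc[of 0 m n] that by (simp add: J_0)
qed

lemma J_2:
  "J 2 n n = (\<alpha> n ^ 2 + \<beta> n + \<beta> (Suc n)) * h n"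
  "J 2 (Suc n) n = (\<alpha> (Suc n) + \<alpha> n) * h (Suc n)"
  "J 2 (Suc (Suc n)) n = h (Suc (Suc n))"
proof -
  show "J 2 n n = (\<alpha> n ^ 2 + \<beta> n + \<beta> (Suc n)) * h n"
    using J_Suc[of 1 n n] beta_0 J_1(2)[of n] J_1(2)[of "n - 1"] J_sym[of 1 "n - 1" n] h_Suc[of "n - 1"]
      J_1(1)[of n]
    by (cases n) (simp_all add: h_Suc numeral_2_eq_2 algebra_simps)
  have "J 2 (Suc n) n = J 1 (Suc (Suc n)) n + \<alpha> (Suc n) * J 1 (Suc n) n + \<beta> (Suc n) * J 1 n n" for n
    using J_Suc[of 1 "Suc n" n] by (simp add: numeral_2_eq_2)
  then show "J 2 (Suc n) n = (\<alpha> (Suc n) + \<alpha> n) * h (Suc n)" for n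
    by (simp add: J_1 h_Suc algebra_simps)
  show "J 2 (Suc (Suc n)) n = h (Suc (Suc n))"
    using J_Suc[of 1 "Suc (Suc n)" n] by (simp add: numeral_2_eq_2 J_1 h_Suc)
qed

lemma J_3:
  "J 3 n n = (\<alpha> n * (\<alpha> n ^ 2 + \<beta> n + \<beta> (Suc n)) + (\<alpha> n + \<alpha> (n - 1)) * \<beta> n
       + (\<alpha> (Suc n) + \<alpha> n) * \<beta> (Suc n)) * h n"
  "J 3 (Suc n) n = (\<alpha> (Suc n) ^ 2 + \<alpha> (Suc n) * \<alpha> n + \<alpha> n ^ 2
      + \<beta> n + \<beta> (Suc n) + \<beta> (Suc (Suc n))) * h (Suc n)"
proof -
  have *: "J 3 m n = J 2 (Suc m) n + \<alpha> m * J 2 m n + \<beta> m * J 2 (m - 1) n" for m n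
    using J_Suc[of 2 m n] by (simp add: numeral_3_eq_3 numeral_2_eq_2)
  show "J 3 n n = (\<alpha> n * (\<alpha> n ^ 2 + \<beta> n + \<beta> (Suc n)) + (\<alpha> n + \<alpha> (n - 1)) * \<beta> n
       + (\<alpha> (Suc n) + \<alpha> n) * \<beta> (Suc n)) * h n"
    using *[of n n] beta_0 J_2(2)[of "n - 1"] J_sym[of 2 "n - 1" n] h_Suc[of "n - 1"]
    by (cases n) (simp_all add: J_2 h_Suc algebra_simps)
  show "J 3 (Suc n) n = (\<alpha> (Suc n) ^ 2 + \<alpha> (Suc n) * \<alpha> n + \<alpha> n ^ 2
      + \<beta> n + \<beta> (Suc n) + \<beta> (Suc (Suc n))) * h (Suc n)"
    using *[of "Suc n" n] by (simp add: J_2 h_Suc algebra_simps power2_eq_square)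
qed

section \<open>The ladder coefficients as moments\<close>

text \<open>\<open>a\<close> and \<open>d\<close> are \<open>P\<^sub>n(0)\<close> and \<open>P\<^sub>n'(0)\<close>. \<open>X n\<close> and \<open>R n\<close> are the coefficients of \<open>z^-2\<close> and \<open>z^-1\<close> in the
  ladder coefficient \<open>A\<^sub>n(z)\<close>; \<open>Y n\<close> and \<open>r (Suc n)\<close> are those of \<open>B\<^sub>n\<^sub>+\<^sub>1(z)\<close>. The index of \<open>Y\<close> is lowered
  by one so that no predecessor of \<open>n\<close> occurs.\<close>

definition a where "a n = coeff (P n) 0"
definition d where "d n = coeff (P n) 1"

abbreviation "R \<equiv> R_coeff \<alpha> \<beta>"
abbreviation "r \<equiv> r_coeff \<alpha> \<beta>"

definition X where "X n = r n + r (Suc n) + \<alpha> n * R n - lam"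
definition Y where "Y n = t * a n * s (Suc n) / h n"

lemma mom_P_mult_pderiv_P_le:
  assumes "m \<le> n"
  shows "mom t lam (P n * pderiv (P m)) = 0"
  using assms by (subst mom_P_mult) (auto simp: degree_pderiv coeff_pderiv coeff_eq_0)

text \<open>Integration by parts with \<open>p = P\<^sub>n\<^sup>2\<close>, where \<open>\<integral> P\<^sub>n P\<^sub>n' w = 0\<close>.\<close>

lemma R_moments: "h n * R n = lam * a n * s n + t * (a n * u n + d n * s n)"
proof -
  have "mom t lam (pderiv (P n * P n)) = 0"
    by (simp only: pderiv_mult mom_simps mom_P_mult_pderiv_P_le order_refl add_0)
  moreover have "mom t (lam - 1) (P n * P n) = a n * s n"
    by (simp add: mom_inv_P_mult coeff_eq_0 a_def)
  moreover have "mom t (lam - 2) (P n * P n) = a n * u n + d n * s n"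
    by (simp add: mom_inv2_P_mult coeff_eq_0 a_def d_def)
  moreover have "mom t (lam + 2) (P n * P n) = (\<alpha> n ^ 2 + \<beta> n + \<beta> (Suc n)) * h n"
    using J_2(1)[of n] by (simp add: J_def)
  ultimately show ?thesis
    using mom_pderiv[OF t, of lam "P n * P n"] by (simp add: R_coeff_def algebra_simps)
qed

lemma pderiv_P_0: "pderiv (P 0) = 0"
  by (simp add: pderiv_eq_0_iff)

lemma mom_P_mult_x_pderiv_P:
  "mom t lam (P n * pCons 0 (pderiv (P n))) = real n * h n"
proof (cases n)
  case 0
  then show ?thesis by (simp add: pderiv_P_0 mom_simps)
next
  case (Suc k)
  have "degree (pCons 0 (pderiv (P n))) \<le> n"
    using degree_pCons_le[of 0 "pderiv (P n)"] by (simp add: degree_pderiv Suc)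
  moreover have "coeff (pCons 0 (pderiv (P n))) n = real n"
    using coeff_P_self[of n] by (simp add: Suc coeff_pderiv del: coeff_P_self)
  ultimately show ?thesis by (simp only: mom_P_mult mult.commute)
qed

text \<open>Integration by parts with \<open>p = x P\<^sub>n\<^sup>2\<close>. The extra factor \<open>x\<close> turns the term with \<open>w/x\<close> into \<open>h\<^sub>n\<close> and
  leaves only \<open>t \<integral> P\<^sub>n\<^sup>2 w/x\<close>; subtracting \<open>(2 n + 1) h\<^sub>n\<close> from \<open>3 J 3 n n\<close> gives \<open>h\<^sub>n (X\<^sub>n + \<lambda>)\<close>.\<close>

lemma X_moments: "h n * X n = t * a n * s n"
proof -
  have "pderiv (pCons 0 (P n * P n)) = P n * P n + P n * pCons 0 (pderiv (P n)) + P n * pCons 0 (pderiv (P n))"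
    by (simp add: pderiv_pCons pderiv_mult mult_pCons_right)
  then have "mom t lam (pderiv (pCons 0 (P n * P n))) = (2 * real n + 1) * h n"
    by (simp only: mom_simps mom_P_mult_x_pderiv_P orth) (simp add: algebra_simps)
  moreover have "mom t (lam - 2) (pCons 0 (P n * P n)) = a n * s n"
    by (simp add: mom_simps mom_inv_P_mult coeff_eq_0 a_def)
  moreover have "mom t (lam - 1) (pCons 0 (P n * P n)) = h n"
    by (simp add: mom_simps orth)
  moreover have "mom t (lam + 2) (pCons 0 (P n * P n)) = J 3 n n"
    by (simp add: mom_simps J_def add_ac)
  ultimately have "(2 * real n + 1) * h n = 3 * J 3 n n - lam * h n - t * (a n * s n)"
    using mom_pderiv[OF t, of lam "pCons 0 (P n * P n)"] by simp
  then show ?thesis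
    unfolding J_3 X_def R_coeff_def r_coeff_def by (simp add: algebra_simps)
qed

lemma mom_P_mult_pderiv_P_Suc:
  "mom t lam (P n * pderiv (P (Suc n))) = (real n + 1) * h n"
  by (subst mom_P_mult) (auto simp: degree_pderiv coeff_pderiv)

text \<open>Integration by parts with \<open>p = P\<^sub>n\<^sub>+\<^sub>1 P\<^sub>n\<close>. The two forms differ in the factor that is expanded at \<open>0\<close>;
  \<open>Y_linear\<close> needs both.\<close>

lemma r_moments:
  "h n * r (Suc n) = lam * a n * s (Suc n) + t * (a n * u (Suc n) + d n * s (Suc n))"
  "h n * r (Suc n) = lam * a n * s (Suc n) + t * (a (Suc n) * u n + d (Suc n) * s n)"
proof -
  have "mom t lam (pderiv (P (Suc n) * P n)) = (real n + 1) * h n"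
    by (simp add: pderiv_mult mom_simps mom_P_mult_pderiv_P_le mom_P_mult_pderiv_P_Suc)
  moreover have "mom t (lam - 1) (P (Suc n) * P n) = a n * s (Suc n)"
    by (simp add: mom_inv_P_mult coeff_eq_0 a_def)
  moreover have "mom t (lam + 2) (P (Suc n) * P n) = (\<alpha> (Suc n) + \<alpha> n) * \<beta> (Suc n) * h n"
    using J_2(2)[of n] by (simp add: J_def h_Suc)
  ultimately have *: "h n * r (Suc n) = lam * a n * s (Suc n) + t * mom t (lam - 2) (P (Suc n) * P n)"
    using mom_pderiv[OF t, of lam "P (Suc n) * P n"] by (simp add: r_coeff_def algebra_simps)
  have "mom t (lam - 2) (P (Suc n) * P n) = a n * u (Suc n) + d n * s (Suc n)"
    by (simp add: mom_inv2_P_mult coeff_eq_0 a_def d_def)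
  with * show "h n * r (Suc n) = lam * a n * s (Suc n) + t * (a n * u (Suc n) + d n * s (Suc n))"
    by simp
  have "mom t (lam - 2) (P n * P (Suc n)) = a (Suc n) * u n + d (Suc n) * s n"
    by (simp add: mom_inv2_P_mult coeff_eq_0 a_def d_def)
  with * show "h n * r (Suc n) = lam * a n * s (Suc n) + t * (a (Suc n) * u n + d (Suc n) * s n)"
    by (simp add: mult.commute)
qed

section \<open>Compatibility relations\<close>

text \<open>The integral of \<open>P\<^sub>n P\<^sub>n\<^sub>+\<^sub>1 w / x\<close>, with either factor expanded at \<open>0\<close>. If \<open>P\<^sub>n\<^sub>+\<^sub>1\<close> is expanded, its degree is one
  too large for orthogonality, which produces \<open>h n\<close>.\<close>

lemma casorati: "a n * s (Suc n) - a (Suc n) * s n = h n"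
proof -
  have "mom t (lam - 1) (P (Suc n) * P n) = a n * s (Suc n)"
    by (simp add: mom_inv_P_mult coeff_eq_0 a_def)
  moreover have "mom t (lam - 1) (P n * P (Suc n)) = a (Suc n) * s n + h n"
    by (simp add: mom_inv_P_mult a_def)
  ultimately show ?thesis by (simp add: mult.commute)
qed

lemma a_rec: "a (Suc n) + \<alpha> n * a n + \<beta> n * a (n - 1) = 0"
  using arg_cong[OF rec[of n], of "\<lambda>p. coeff p 0"] by (simp add: a_def)

lemma Y_minus_t: "Y n - t = t * a (Suc n) * s n / h n"
proof -
  have "Y n - t = t * (a n * s (Suc n) - h n) / h n"
    using h_pos[of n] by (simp add: Y_def field_simps)
  also have "a n * s (Suc n) - h n = a (Suc n) * s n"
    using casorati[of n] by linarith
  finally show ?thesis by (simp add: mult.assoc)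
qed

text \<open>\<open>Y n\<close> and \<open>Y n - t\<close> are the two mixed products of \<open>a\<close> and \<open>s\<close> at the indices \<open>n\<close> and \<open>n + 1\<close>, while \<open>X n\<close> and
  \<open>X (Suc n)\<close> are the two diagonal ones; the product of all four values is the same either way.\<close>

lemma Y_quadratic: "Y n * (Y n - t) = \<beta> (Suc n) * X (Suc n) * X n"
proof -
  have "X m = t * a m * s m / h m" for m
    using X_moments[of m] h_pos[of m] by (simp add: field_simps)
  moreover have "\<beta> (Suc n) \<noteq> 0"
    using h_pos[of "Suc n"] by (auto simp: h_Suc)
  ultimately show ?thesis
    using h_pos[of n] unfolding Y_minus_t
    by (simp add: Y_def field_simps h_Suc)
qed

text \<open>Written as \<open>r Y + r (Y - t) - \<lambda> Y = \<beta> (X\<^sub>n\<^sub>+\<^sub>1 R\<^sub>n + X\<^sub>n R\<^sub>n\<^sub>+\<^sub>1)\<close>. Using one form of \<open>r_moments\<close> for each of the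
  two products on the left, the terms with \<open>u\<close> and \<open>d\<close> match those on the right one by one, and \<open>casorati\<close>
  reduces the remaining terms with \<open>\<lambda>\<close>.\<close>

lemma Y_linear:
  "(2 * r (Suc n) - lam) * Y n = t * r (Suc n) + \<beta> (Suc n) * (X (Suc n) * R n + X n * R (Suc n))"
proof -
  define g where "g = h n"
  have g: "g \<noteq> 0" using h_pos[of n] by (simp add: g_def)
  have Y: "g * Y n = t * a n * s (Suc n)" "g * (Y n - t) = t * a (Suc n) * s n"
    using h_pos[of n] unfolding Y_minus_t by (simp_all add: Y_def g_def)
  have X: "g * X n = t * a n * s n" "\<beta> (Suc n) * g * X (Suc n) = t * a (Suc n) * s (Suc n)"
    using X_moments[of n] X_moments[of "Suc n"] by (simp_all add: h_Suc g_def)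
  have R: "g * R n = lam * a n * s n + t * (a n * u n + d n * s n)"
     "\<beta> (Suc n) * g * R (Suc n) = lam * a (Suc n) * s (Suc n) + t * (a (Suc n) * u (Suc n) + d (Suc n) * s (Suc n))"
    using R_moments[of n] R_moments[of "Suc n"] by (simp_all add: h_Suc g_def)
  note r = r_moments[of n, folded g_def]
  have 1: "(g * r (Suc n)) * (g * (Y n - t))
      = (lam * a n * s (Suc n) + t * (a n * u (Suc n) + d n * s (Suc n))) * (t * a (Suc n) * s n)"
    by (simp only: r(1) Y(2))
  have 2: "(g * r (Suc n)) * (g * Y n)
      = (lam * a n * s (Suc n) + t * (a (Suc n) * u n + d (Suc n) * s n)) * (t * a n * s (Suc n))"
    by (simp only: r(2) Y(1))
  have 3: "g * lam * (g * Y n)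
      = (a n * s (Suc n) - a (Suc n) * s n) * lam * (t * a n * s (Suc n))"
    by (subst Y(1)) (simp add: casorati g_def)
  have "g * g * ((2 * r (Suc n) - lam) * Y n - t * r (Suc n))
     = (g * r (Suc n)) * (g * (Y n - t)) + (g * r (Suc n)) * (g * Y n) - g * lam * (g * Y n)"
    by (simp add: algebra_simps)
  also have "\<dots> = (lam * a n * s (Suc n) + t * (a n * u (Suc n) + d n * s (Suc n))) * (t * a (Suc n) * s n)
     + (lam * a n * s (Suc n) + t * (a (Suc n) * u n + d (Suc n) * s n)) * (t * a n * s (Suc n))
     - (a n * s (Suc n) - a (Suc n) * s n) * lam * (t * a n * s (Suc n))"
    by (simp only: 1 2 3)
  also have "\<dots> = (t * a (Suc n) * s (Suc n)) * (lam * a n * s n + t * (a n * u n + d n * s n))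
    + (t * a n * s n) * (lam * a (Suc n) * s (Suc n) + t * (a (Suc n) * u (Suc n) + d (Suc n) * s (Suc n)))"
    by (simp add: algebra_simps)
  also have "\<dots> = g * g * (\<beta> (Suc n) * (X (Suc n) * R n + X n * R (Suc n)))"
    unfolding X[symmetric] R[symmetric] by (simp add: algebra_simps)
  finally show ?thesis using g by simp
qed

text \<open>After clearing \<open>h (Suc n)\<close> this is the three-term recurrence at \<open>x = 0\<close>, times \<open>t s\<^sub>n\<^sub>+\<^sub>1\<close>.\<close>

lemma Y_sum: "Y (Suc n) + Y n = t - \<alpha> (Suc n) * X (Suc n)"
proof -
  define H where "H = h (Suc n)"
  have H: "H \<noteq> 0" using h_pos[of "Suc n"] by (simp add: H_def)
  have 1: "H * (Y (Suc n) - t) = t * a (Suc (Suc n)) * s (Suc n)"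
    using H unfolding Y_minus_t by (simp add: H_def)
  have 2: "H * Y n = t * \<beta> (Suc n) * a n * s (Suc n)"
    using h_pos[of n] by (simp add: Y_def H_def h_Suc)
  have 3: "H * X (Suc n) = t * a (Suc n) * s (Suc n)"
    by (simp add: X_moments H_def)
  have "H * (Y (Suc n) + Y n - t + \<alpha> (Suc n) * X (Suc n))
     = t * s (Suc n) * (a (Suc (Suc n)) + \<alpha> (Suc n) * a (Suc n) + \<beta> (Suc n) * a (Suc n - 1))"
    using 1 2 3 by (simp add: algebra_simps)
  then show ?thesis using H by (simp only: a_rec) simp
qed

text \<open>The subleading coefficient of \<open>P\<^sub>n\<^sub>+\<^sub>1\<close>. It equals \<open>- (\<alpha>\<^sub>0 + \<dots> + \<alpha>\<^sub>n)\<close>, so it is not a local expression in the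
  recurrence coefficients, but only its increment \<open>- \<alpha>\<^sub>n\<^sub>+\<^sub>1\<close> enters \<open>Y_diff\<close>.\<close>

definition c where "c n = coeff (P (Suc n)) n"

lemma c_Suc: "c (Suc n) = c n - \<alpha> (Suc n)"
  using arg_cong[OF rec[of "Suc n"], of "\<lambda>p. coeff p (Suc n)"]
  by (simp add: c_def coeff_eq_0)

text \<open>Integration by parts with \<open>p = x P\<^sub>n\<^sub>+\<^sub>1 P\<^sub>n\<close>.\<close>

lemma Y_moments:
  "Y n = 3 * \<beta> (Suc n) * (\<alpha> (Suc n) ^ 2 + \<alpha> (Suc n) * \<alpha> n + \<alpha> n ^ 2
      + \<beta> n + \<beta> (Suc n) + \<beta> (Suc (Suc n))) + c n"
proof -
  \<comment> \<open>\<open>x P\<^sub>n\<^sub>+\<^sub>1'\<close> has degree \<open>n + 1\<close>; subtracting \<open>(n + 1) P\<^sub>n\<^sub>+\<^sub>1\<close>, which is orthogonal to \<open>P\<^sub>n\<close>,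
    makes the coefficient formula for degree at most \<open>n\<close> applicable.\<close>
  let ?q = "pCons 0 (pderiv (P (Suc n))) - smult (real n + 1) (P (Suc n))"
  have top: "coeff ?q (Suc n) = 0"
    by (simp add: coeff_pderiv)
  have "degree ?q \<le> n"
  proof (rule degree_le, safe)
    fix i assume "n < i"
    then show "coeff ?q i = 0"
      using top by (cases "i = Suc n") (auto simp: coeff_pCons coeff_pderiv coeff_eq_0 split: nat.split)
  qed
  then have "mom t lam (P n * ?q) = h n * coeff ?q n" by (rule mom_P_mult)
  also have "coeff ?q n = - c n"
    by (cases n) (simp_all add: c_def coeff_pderiv algebra_simps)
  finally have "mom t lam (P n * pCons 0 (pderiv (P (Suc n)))) = - h n * c n"
    by (simp add: right_diff_distrib mom_simps orth)
  moreover have "mom t lam (P (Suc n) * pCons 0 (pderiv (P n))) = 0"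
  proof -
    have "degree (pCons 0 (pderiv (P n))) < Suc n"
      using degree_pCons_le[of 0 "pderiv (P n)"] by (cases n) (auto simp: degree_pderiv pderiv_P_0)
    then show ?thesis by (subst mom_P_mult) (simp_all add: coeff_eq_0 del: coeff_pCons_Suc)
  qed
  moreover have "pderiv (pCons 0 (P (Suc n) * P n)) = P (Suc n) * P n + P n * pCons 0 (pderiv (P (Suc n)))
      + P (Suc n) * pCons 0 (pderiv (P n))"
    by (simp add: pderiv_pCons pderiv_mult mult_pCons_right)
  ultimately have "mom t lam (pderiv (pCons 0 (P (Suc n) * P n))) = - h n * c n"
    by (simp add: mom_simps orth)
  moreover have "mom t (lam - 2) (pCons 0 (P (Suc n) * P n)) = a n * s (Suc n)"
    by (simp add: mom_simps mom_inv_P_mult coeff_eq_0 a_def)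
  moreover have "mom t (lam - 1) (pCons 0 (P (Suc n) * P n)) = 0"
    by (simp add: mom_simps orth)
  moreover have "mom t (lam + 2) (pCons 0 (P (Suc n) * P n)) = J 3 (Suc n) n"
    by (simp add: mom_simps J_def add_ac)
  ultimately have "t * (a n * s (Suc n)) = 3 * J 3 (Suc n) n + h n * c n"
    using mom_pderiv[OF t, of lam "pCons 0 (P (Suc n) * P n)"] by simp
  then show ?thesis
    using h_pos[of n] unfolding J_3 Y_def by (simp add: h_Suc field_simps)
qed

lemma Y_diff:
  "Y n - Y (Suc n) = \<beta> (Suc n) * (3 * \<alpha> (Suc n) * \<alpha> n + R (Suc n) + R n) - 3 * (\<beta> (Suc n))\<^sup>2
    - \<beta> (Suc (Suc n)) * (3 * \<alpha> (Suc (Suc n)) * \<alpha> (Suc n) + R (Suc (Suc n)) + R (Suc n))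
    + 3 * (\<beta> (Suc (Suc n)))\<^sup>2 + \<alpha> (Suc n)"
  unfolding Y_moments c_Suc R_coeff_def by (simp add: algebra_simps power2_eq_square)

section \<open>The difference equations\<close>

text \<open>By \<open>Y_linear\<close> the two brackets are \<open>(2 r - \<lambda>) Y\<close> and \<open>(2 r - \<lambda>) (Y - t)\<close>; their product is given by
  \<open>Y_quadratic\<close>.\<close>

lemma first_difference_equation:
  "(X (Suc n) * \<beta> (Suc n) * R n + X n * \<beta> (Suc n) * R (Suc n) + t * r (Suc n))
     * (X (Suc n) * \<beta> (Suc n) * R n + X n * \<beta> (Suc n) * R (Suc n) - t * r (Suc n) + lam * t)
   = \<beta> (Suc n) * (2 * r (Suc n) - lam)\<^sup>2 * X (Suc n) * X n"
proof -
  have "X (Suc n) * \<beta> (Suc n) * R n + X n * \<beta> (Suc n) * R (Suc n) + t * r (Suc n)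
      = (2 * r (Suc n) - lam) * Y n"
    unfolding Y_linear by (simp add: algebra_simps)
  moreover have "X (Suc n) * \<beta> (Suc n) * R n + X n * \<beta> (Suc n) * R (Suc n) - t * r (Suc n) + lam * t
      = (2 * r (Suc n) - lam) * (Y n - t)"
    using Y_linear[of n] by (simp add: algebra_simps)
  moreover have "((2 * r (Suc n) - lam) * Y n) * ((2 * r (Suc n) - lam) * (Y n - t))
      = (2 * r (Suc n) - lam)\<^sup>2 * (Y n * (Y n - t))"
    by (simp add: power2_eq_square mult_ac)
  ultimately show ?thesis
    by (simp only: Y_quadratic mult_ac)
qed

text \<open>The terms outside the factor \<open>2 r - \<lambda>\<close> are \<open>2 (2 r - \<lambda>) Y\<close> by \<open>Y_linear\<close>. What remains is \<open>2 r - \<lambda>\<close> times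
  the sum of \<open>Y_sum\<close> and \<open>Y_diff\<close>, so no division by \<open>2 r - \<lambda>\<close>, which may vanish, takes place.\<close>

lemma second_difference_equation:
  "2 * X (Suc n) * \<beta> (Suc n) * R n + 2 * X n * \<beta> (Suc n) * R (Suc n) + 2 * t * r (Suc n)
     + (2 * r (Suc n) - lam)
       * (\<alpha> (Suc n) * (X (Suc n) - 1) + 3 * (\<beta> (Suc n))\<^sup>2 - 3 * (\<beta> (Suc (Suc n)))\<^sup>2 - t)
   = (2 * r (Suc n) - lam)
       * (\<beta> (Suc n) * (3 * \<alpha> (Suc n) * \<alpha> n + R (Suc n) + R n)
          - \<beta> (Suc (Suc n)) * (3 * \<alpha> (Suc (Suc n)) * \<alpha> (Suc n) + R (Suc (Suc n)) + R (Suc n)))"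
  (is "?E + ?k * ?A = ?k * ?B")
proof -
  have "?E = ?k * (2 * Y n)"
    using Y_linear[of n] by (simp add: algebra_simps)
  moreover have "2 * Y n + ?A = ?B"
    using Y_sum[of n] Y_diff[of n] by (simp add: right_diff_distrib)
  ultimately show ?thesis
    by (simp only: distrib_left[symmetric])
qed

end

theorem theorem2p3:
  fixes lam t :: real
    and P :: "nat \<Rightarrow> real poly" and h \<alpha> \<beta> R r :: "nat \<Rightarrow> real" and n :: nat
  assumes "lam > -1" and "t > 0"
    and "monic_orthogonal_polys (weight lam t) P h"
    and "recurrence_coeffs P \<alpha> \<beta>"
    and "R = R_coeff \<alpha> \<beta>" and "r = r_coeff \<alpha> \<beta>"
    and "n \<ge> 1"
  shows
    "((r n + r (n + 1) + \<alpha> n * R n - lam) * \<beta> n * R (n - 1)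
        + (r (n - 1) + r n + \<alpha> (n - 1) * R (n - 1) - lam) * \<beta> n * R n + t * r n)
     * ((r n + r (n + 1) + \<alpha> n * R n - lam) * \<beta> n * R (n - 1)
        + (r (n - 1) + r n + \<alpha> (n - 1) * R (n - 1) - lam) * \<beta> n * R n - t * r n + lam * t)
     = \<beta> n * (2 * r n - lam)\<^sup>2
        * (r n + r (n + 1) + \<alpha> n * R n - lam)
        * (r (n - 1) + r n + \<alpha> (n - 1) * R (n - 1) - lam)
   \<and>
     2 * (r n + r (n + 1) + \<alpha> n * R n - lam) * \<beta> n * R (n - 1)
        + 2 * (r (n - 1) + r n + \<alpha> (n - 1) * R (n - 1) - lam) * \<beta> n * R n + 2 * t * r n
        + (2 * r n - lam)
          * (\<alpha> n * (r n + r (n + 1) + \<alpha> n * R n - lam - 1)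
             + 3 * (\<beta> n)\<^sup>2 - 3 * (\<beta> (n + 1))\<^sup>2 - t)
     = (2 * r n - lam)
        * (\<beta> n * (3 * \<alpha> n * \<alpha> (n - 1) + R n + R (n - 1))
           - \<beta> (n + 1) * (3 * \<alpha> (n + 1) * \<alpha> n + R (n + 1) + R n))"
proof -
  have W: "weight_orthogonal_polys lam t P h \<alpha> \<beta>"
    by (rule weight_orthogonal_polys.intro) (fact assms)+
  obtain m where n: "n = Suc m" using \<open>n \<ge> 1\<close> by (cases n) auto
  show ?thesis
    using weight_orthogonal_polys.first_difference_equation[OF W, of m]
      weight_orthogonal_polys.second_difference_equation[OF W, of m]
    unfolding weight_orthogonal_polys.X_def[OF W] n assms(5,6) diff_Suc_1 Suc_eq_plus1[symmetric]
    by (rule conjI)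
qed

end
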